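(* Let $n\ge 2$ and let $\Omega\subset\mathbb{R}^n$ be a bounded convex domain. Let $\varphi$ be a Young function, let $u\in D'(\Omega,\Lambda^l)$, $l\in\{1,2,\ldots,n\}$, be a differential form in $\Omega$ with $\varphi(|u|)\in L^1_{loc}(\Omega)$, and let $k$ be a constant with $0<k<1$. Then there exists a constant $C$, independent of $u$, such that $$\|u\|_{\varphi*,\Omega}\le C\,\|u\|_{\varphi\,loc\,Lip_k,\Omega}.$$
   Context: Forms: $\Lambda^l=\Lambda^l(\mathbb{R}^n)$ is the space of $l$-forms (exterior $l$-vectors) on $\mathbb{R}^n$; $D'(\Omega,\Lambda^l)$ is the space of differential $l$-forms $u=\sum_I u_I\,dx_I$ on $\Omega$, and $|u|$ is the pointwise modulus, $|u|^2=\star(u\wedge\star u)$. $B$ and $\sigma B$ denote concentric balls with $\mathrm{diam}(\sigma B)=\sigma\,\mathrm{diam}(B)$; $|E|$ is Lebesgue measure. The homotopy operator $T$ maps $l$-forms to $(l-1)$-forms by $Tu=\int_\Omega\psi(y)K_yu\,dy$, where $\psi\in C_0^\infty(\Omega)$ is normalized by $\int_\Omega\psi=1$ and $$(K_yu)(x;\xi_1,\ldots,\xi_{l-1})=\int_0^1t^{l-1}u(tx+y-ty;\,x-y,\xi_1,\ldots,\xi_{l-1})\,dt.$$ For an $l$-form $u$ with $1\le l\le n$ set $u_\Omega=d(Tu)$; for a $0$-form set $u_\Omega=|\Omega|^{-1}\int_\Omega u(y)\,dy$. For a ball $B$, $u_B$ is defined in the same way with $B$ in place of $\Omega$. Young function: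 a convex Orlicz function $\varphi:[0,\infty)\to[0,\infty)$ (continuous, increasing, $\varphi(0)=0$). Luxemburg norm: $\|f\|_{\varphi,E}=\inf\{\lambda>0:\int_E\varphi(|f|/\lambda)\,dx\le 1\}$. Norms: for $u\in L^1_{loc}(\Omega,\Lambda^l)$ and $0<k<1$, $$\|u\|_{\varphi\,loc\,Lip_k,\Omega}=\sup_{\sigma B\subset\Omega}|B|^{-(n+k)/n}\|u-u_B\|_{\varphi,B},\qquad \|u\|_{\varphi*,\Omega}=\sup_{\sigma B\subset\Omega}|B|^{-1}\|u-u_B\|_{\varphi,B},$$ for some $\sigma>1$, the same in both norms (supremum over balls $B$ with $\sigma B\subset\Omega$). *)

theory Defs
  imports "HOL-Analysis.Analysis"
begin

section \<open>Exterior forms\<close>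

text \<open>
  An exterior form on \<open>real^'n\<close> is given by its coefficients: \<open>\<alpha>\<close> stands for
  \<open>\<Sum>I. \<alpha> I dx_I\<close>, where \<open>dx_I = dx_i1 \<and> \<dots> \<and> dx_il\<close> and \<open>i1 < \<dots> < il\<close> are the elements of
  \<open>I\<close>.  The linear order on \<open>'n\<close> fixes the orientation.
\<close>

type_synonym 'n euclid = "real^'n"

type_synonym 'n ext_form = "'n set \<Rightarrow> real"

text \<open>
  For disjoint \<open>I\<close>, \<open>J\<close>: \<open>dx_I \<and> dx_J = shuffle_sign I J * dx_(I \<union> J)\<close>.
\<close>

definition shuffle_sign :: "'n::{finite,linorder} set \<Rightarrow> 'n set \<Rightarrow> real" where
  "shuffle_sign I J = (- 1) ^ card {(i, j). i \<in> I \<and> j \<in> J \<and> j < i}"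

definition wedge ::
  "'n::{finite,linorder} ext_form \<Rightarrow> 'n ext_form \<Rightarrow> 'n ext_form" where
  "wedge \<alpha> \<beta> = (\<lambda>K. \<Sum>I\<in>Pow K. shuffle_sign I (K - I) * \<alpha> I * \<beta> (K - I))"

text \<open>Hodge star: \<open>dx_I\<close> is mapped to \<open>shuffle_sign I (- I) * dx_(- I)\<close>.\<close>

definition hodge :: "'n::{finite,linorder} ext_form \<Rightarrow> 'n ext_form" where
  "hodge \<alpha> = (\<lambda>J. shuffle_sign (- J) J * \<alpha> (- J))"

text \<open>\<open>hodge (wedge \<alpha> (hodge \<alpha>))\<close> is a 0-form, i.e. a number, its coefficient at \<open>{}\<close>.\<close>

definition form_modulus :: "'n::{finite,linorder} ext_form \<Rightarrow> real" where
  "form_modulus \<alpha> = sqrt (hodge (wedge \<alpha> (hodge \<alpha>)) {})"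

lemma form_modulus_eq: "form_modulus \<alpha> = sqrt (\<Sum>I\<in>UNIV. (\<alpha> I)\<^sup>2)"
proof -
  have sq: "shuffle_sign I J * shuffle_sign I J = 1" for I J :: "'a set"
    by (simp add: shuffle_sign_def flip: power_mult_distrib)
  have "hodge (wedge \<alpha> (hodge \<alpha>)) {} =
      (\<Sum>I\<in>UNIV. shuffle_sign I (- I) * \<alpha> I * (shuffle_sign I (- I) * \<alpha> I))"
    by (simp add: hodge_def wedge_def shuffle_sign_def Compl_eq_Diff_UNIV[symmetric])
  also have "\<dots> = (\<Sum>I\<in>UNIV. (\<alpha> I)\<^sup>2)"
  proof (rule sum.cong[OF refl])
    fix I :: "'a set"
    have "shuffle_sign I (- I) * \<alpha> I * (shuffle_sign I (- I) * \<alpha> I) =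
        (shuffle_sign I (- I) * shuffle_sign I (- I)) * (\<alpha> I)\<^sup>2"
      by (simp add: power2_eq_square algebra_simps)
    then show "shuffle_sign I (- I) * \<alpha> I * (shuffle_sign I (- I) * \<alpha> I) = (\<alpha> I)\<^sup>2"
      using sq by simp
  qed
  finally show ?thesis
    by (simp add: form_modulus_def)
qed

text \<open>
  The value of a form on a list of vectors, with
  \<open>dx_I (\<xi>_1, \<dots>, \<xi>_l) = det (dx_ib (\<xi>_a))\<close>; only the part of degree \<open>length \<xi>\<close> contributes.
\<close>

definition form_apply :: "'n::{finite,linorder} ext_form \<Rightarrow> 'n euclid list \<Rightarrow> real" where
  "form_apply \<alpha> \<xi> = (\<Sum>I | card I = length \<xi>. \<alpha> I *
     (\<Sum>p | p permutes {..<length \<xi>}.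
        of_int (sign p) * (\<Prod>a<length \<xi>. (\<xi> ! a) $ (sorted_list_of_set I ! p a))))"

definition basis_list :: "'n::{finite,linorder} set \<Rightarrow> 'n euclid list" where
  "basis_list I = map (\<lambda>i. axis i 1) (sorted_list_of_set I)"


section \<open>Differential forms and distributional forms\<close>

type_synonym 'n diff_form = "'n euclid \<Rightarrow> 'n ext_form"

definition locally_integrable :: "'n::finite euclid set \<Rightarrow> ('n euclid \<Rightarrow> real) \<Rightarrow> bool" where
  "locally_integrable \<Omega> f \<longleftrightarrow>
     (\<forall>K. compact K \<and> K \<subseteq> \<Omega> \<longrightarrow> set_integrable lebesgue K f)"

definition L1loc_form :: "'n::{finite,linorder} euclid set \<Rightarrow> nat \<Rightarrow> 'n diff_form \<Rightarrow> bool" where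
  "L1loc_form \<Omega> l u \<longleftrightarrow>
     (\<forall>x\<in>\<Omega>. \<forall>I. card I \<noteq> l \<longrightarrow> u x I = 0) \<and>
     (\<forall>I. locally_integrable \<Omega> (\<lambda>x. u x I))"

definition partial_deriv :: "'n::finite \<Rightarrow> ('n euclid \<Rightarrow> real) \<Rightarrow> ('n euclid \<Rightarrow> real)" where
  "partial_deriv i f = (\<lambda>x. frechet_derivative f (at x) (axis i 1))"

definition smooth :: "('n::finite euclid \<Rightarrow> real) \<Rightarrow> bool" where
  "smooth f \<longleftrightarrow> (\<forall>js. foldr partial_deriv js f differentiable_on UNIV)"

definition test_function :: "'n::finite euclid set \<Rightarrow> ('n euclid \<Rightarrow> real) \<Rightarrow> bool" where
  "test_function \<Omega> \<eta> \<longleftrightarrow> smooth \<eta> \<and>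
     compact (closure {x. \<eta> x \<noteq> 0}) \<and> closure {x. \<eta> x \<noteq> 0} \<subseteq> \<Omega>"

text \<open>
  Forms with distributional coefficients: the coefficient at \<open>I\<close> is a functional on test functions.
\<close>

type_synonym 'n dist_form = "'n set \<Rightarrow> ('n euclid \<Rightarrow> real) \<Rightarrow> real"

definition regular_dist ::
  "'n euclid set \<Rightarrow> 'n::{finite,linorder} diff_form \<Rightarrow> 'n dist_form" where
  "regular_dist \<Omega> w = (\<lambda>I \<eta>. LINT x:\<Omega>|lebesgue. w x I * \<eta> x)"

text \<open>
  Exterior derivative: \<open>d (\<Sum>J. F_J dx_J) = \<Sum>i. \<Sum>J. \<partial>_i F_J dx_i \<and> dx_J\<close>, where
  \<open>\<partial>_i F_J\<close> is the distributional derivative \<open>\<eta> \<mapsto> - F_J (\<partial>_i \<eta>)\<close>.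
\<close>

definition dist_d :: "'n::{finite,linorder} dist_form \<Rightarrow> 'n dist_form" where
  "dist_d F = (\<lambda>I \<eta>. \<Sum>i\<in>I. shuffle_sign {i} (I - {i}) *
     (- F (I - {i}) (partial_deriv i \<eta>)))"


section \<open>The homotopy operator and the averages of a form\<close>

definition homotopy_K ::
  "nat \<Rightarrow> 'n::{finite,linorder} diff_form \<Rightarrow> 'n euclid \<Rightarrow> 'n euclid \<Rightarrow> 'n euclid list \<Rightarrow> real" where
  "homotopy_K l u y x \<xi> = (LINT t:{0..1}|lebesgue.
     t ^ (l - 1) * form_apply (u (t *\<^sub>R x + y - t *\<^sub>R y)) ((x - y) # \<xi>))"

definition homotopy_T ::
  "('n euclid \<Rightarrow> real) \<Rightarrow> 'n euclid set \<Rightarrow> nat \<Rightarrow> 'n::{finite,linorder} diff_form \<Rightarrow> 'n diff_form"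
  where
  "homotopy_T \<psi> B l u = (\<lambda>x J. if card J = l - 1
     then LINT y:B|lebesgue. \<psi> y * homotopy_K l u y x (basis_list J) else 0)"

definition normalized_bump :: "'n::finite euclid set \<Rightarrow> ('n euclid \<Rightarrow> real) \<Rightarrow> bool" where
  "normalized_bump B \<psi> \<longleftrightarrow> test_function B \<psi> \<and> (LINT y:B|lebesgue. \<psi> y) = 1"

text \<open>
  \<open>u_B\<close> for an \<open>l\<close>-form \<open>u\<close>.  For \<open>l \<ge> 1\<close> and a locally integrable \<open>u\<close>, the form \<open>d (T u)\<close> exists in
  general only as a distribution.
\<close>

definition form_average ::
  "('n euclid \<Rightarrow> real) \<Rightarrow> 'n euclid set \<Rightarrow> nat \<Rightarrow> 'n::{finite,linorder} diff_form \<Rightarrow> 'n dist_form"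
  where
  "form_average \<psi> B l u = (if l = 0
     then regular_dist B (\<lambda>x I. if I = {}
            then (LINT y:B|lebesgue. u y {}) / measure lebesgue B else 0)
     else dist_d (regular_dist B (homotopy_T \<psi> B l u)))"


section \<open>Norms\<close>

definition young_function :: "(real \<Rightarrow> real) \<Rightarrow> bool" where
  "young_function \<phi> \<longleftrightarrow> continuous_on {0..} \<phi> \<and> mono_on {0..} \<phi> \<and>
     convex_on {0..} \<phi> \<and> \<phi> 0 = 0"

text \<open>The infimum of the empty set is \<open>\<infinity>\<close>.\<close>

definition luxemburg_norm ::
  "(real \<Rightarrow> real) \<Rightarrow> 'n::finite euclid set \<Rightarrow> ('n euclid \<Rightarrow> real) \<Rightarrow> ennreal" where
  "luxemburg_norm \<phi> E f =
     Inf {ennreal s | s. s > 0 \<and> (\<integral>\<^sup>+x\<in>E. ennreal (\<phi> (\<bar>f x\<bar> / s)) \<partial>lebesgue) \<le> 1}"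

text \<open>
  Luxemburg norm of a distributional form: the norm of the modulus of the (almost everywhere
  unique) locally integrable form that represents it, and \<open>\<infinity>\<close> if there is none.
\<close>

definition luxemburg_norm_dist ::
  "(real \<Rightarrow> real) \<Rightarrow> 'n::{finite,linorder} euclid set \<Rightarrow> 'n dist_form \<Rightarrow> ennreal" where
  "luxemburg_norm_dist \<phi> E F =
     Inf {luxemburg_norm \<phi> E (\<lambda>x. form_modulus (f x)) | f.
       (\<forall>I. locally_integrable E (\<lambda>x. f x I)) \<and>
       (\<forall>I \<eta>. test_function E \<eta> \<longrightarrow> F I \<eta> = regular_dist E f I \<eta>)}"

text \<open>\<open>\<parallel>u - u_B\<parallel>\<close> in the Luxemburg norm on \<open>B\<close>.\<close>

definition oscillation ::
  "(real \<Rightarrow> real) \<Rightarrow> ('n euclid \<Rightarrow> real) \<Rightarrow> 'n euclid set \<Rightarrow> nat \<Rightarrow>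
   'n::{finite,linorder} diff_form \<Rightarrow> ennreal" where
  "oscillation \<phi> \<psi> B l u = luxemburg_norm_dist \<phi> B
     (\<lambda>I \<eta>. regular_dist B u I \<eta> - form_average \<psi> B l u I \<eta>)"

definition admissible_balls :: "real \<Rightarrow> 'n::finite euclid set \<Rightarrow> 'n euclid set set" where
  "admissible_balls \<sigma> \<Omega> = {ball c r | c r. r > 0 \<and> ball c (\<sigma> * r) \<subseteq> \<Omega>}"

text \<open>\<open>\<psi> B\<close> is the normalized function used in the homotopy operator of the ball \<open>B\<close>.\<close>

definition phi_loc_Lip_norm ::
  "(real \<Rightarrow> real) \<Rightarrow> real \<Rightarrow> ('n euclid set \<Rightarrow> 'n euclid \<Rightarrow> real) \<Rightarrow> real \<Rightarrow> 'n euclid set \<Rightarrow> nat \<Rightarrow>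
   'n::{finite,linorder} diff_form \<Rightarrow> ennreal" where
  "phi_loc_Lip_norm \<phi> k \<psi> \<sigma> \<Omega> l u = (SUP B\<in>admissible_balls \<sigma> \<Omega>.
     ennreal (measure lebesgue B powr (- (real CARD('n) + k) / real CARD('n))) *
     oscillation \<phi> (\<psi> B) B l u)"

definition phi_star_norm ::
  "(real \<Rightarrow> real) \<Rightarrow> ('n euclid set \<Rightarrow> 'n euclid \<Rightarrow> real) \<Rightarrow> real \<Rightarrow> 'n euclid set \<Rightarrow> nat \<Rightarrow>
   'n::{finite,linorder} diff_form \<Rightarrow> ennreal" where
  "phi_star_norm \<phi> \<psi> \<sigma> \<Omega> l u = (SUP B\<in>admissible_balls \<sigma> \<Omega>.
     ennreal (inverse (measure lebesgue B)) * oscillation \<phi> (\<psi> B) B l u)"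

end

theory Submission
  imports Defs
begin

text \<open>
  A ball \<open>B\<close> of volume \<open>v\<close> contributes \<open>v\<^sup>-\<^sup>1 = v powr (k / n) * v powr (- (n + k) / n)\<close> times its
  oscillation.  All admissible balls lie in the bounded set \<open>\<Omega>\<close>, so the first factor is at most
  \<open>C = (measure \<Omega>) powr (k / n)\<close>.
\<close>

text \<open>Only the dilated ball is required to lie in \<open>\<Omega>\<close>; as
  \<open>\<sigma> > 1\<close>, it contains the concentric ball \<open>B\<close>.\<close>

lemma admissible_ball_subset:
  assumes "B \<in> admissible_balls \<sigma> \<Omega>" and "\<sigma> > 1"
  shows "B \<subseteq> \<Omega>"
proof -
  obtain c r where B: "B = ball c r" and "r > 0" and sub: "ball c (\<sigma> * r) \<subseteq> \<Omega>"
    using assms(1) by (auto simp: admissible_balls_def)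
  have "r \<le> \<sigma> * r"
    using \<open>r > 0\<close> \<open>\<sigma> > 1\<close> by simp
  then show ?thesis
    using B sub subset_ball by blast
qed

text \<open>The exponents \<open>k / n\<close> and \<open>- (n + k) / n\<close> add up to
  \<open>- 1\<close>, and the first is positive, so enlarging its base from \<open>v\<close> to
  \<open>m\<close> can only increase the product.\<close>

lemma inverse_le_powr_mult_powr:
  fixes v m n k :: real
  assumes "0 < v" and "v \<le> m" and "0 < n" and "0 < k"
  shows "inverse v \<le> m powr (k / n) * v powr (- (n + k) / n)"
proof -
  have "k / n + - (n + k) / n = - 1"
    using \<open>0 < n\<close> by (simp add: field_simps)
  then have "inverse v = v powr (k / n) * v powr (- (n + k) / n)"
    using \<open>0 < v\<close> by (simp only: powr_add[symmetric]) (simp add: powr_minus)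
  also have "\<dots> \<le> m powr (k / n) * v powr (- (n + k) / n)"
    using assms by (intro mult_right_mono powr_mono2) auto
  finally show ?thesis .
qed

theorem theorem3p4:
  fixes \<Omega> :: "'n::{finite,linorder} euclid set"
    and \<phi> :: "real \<Rightarrow> real"
    and \<psi> :: "'n euclid set \<Rightarrow> 'n euclid \<Rightarrow> real"
    and k \<sigma> :: real
    and l :: nat
  assumes "CARD('n) \<ge> 2"
    and "open \<Omega>" and "\<Omega> \<noteq> {}" and "bounded \<Omega>" and "convex \<Omega>"
    and "young_function \<phi>"
    and "l \<in> {1..CARD('n)}"
    and "0 < k" and "k < 1"
    and "\<sigma> > 1"
    and "\<And>B. B \<in> admissible_balls \<sigma> \<Omega> \<Longrightarrow> normalized_bump B (\<psi> B)"
  shows "\<exists>C::real. C > 0 \<and> (\<forall>u :: 'n diff_form.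
    L1loc_form \<Omega> l u \<and> locally_integrable \<Omega> (\<lambda>x. \<phi> (form_modulus (u x))) \<longrightarrow>
    phi_star_norm \<phi> \<psi> \<sigma> \<Omega> l u \<le> ennreal C * phi_loc_Lip_norm \<phi> k \<psi> \<sigma> \<Omega> l u)"
proof -
  define C where "C = measure lebesgue \<Omega> powr (k / real CARD('n))"
  \<comment> \<open>Finiteness matters: \<open>measure\<close> is 0 on sets of infinite measure, so
    it is monotone only below sets of finite measure.\<close>
  have fin: "\<Omega> \<in> lmeasurable"
    using \<open>open \<Omega>\<close> \<open>bounded \<Omega>\<close> by (rule lmeasurable_open[rotated])
  \<comment> \<open>A nonempty open set is not null; this gives \<open>C > 0\<close>, since
    \<open>powr\<close> vanishes at base 0.\<close>
  have "measure lebesgue \<Omega> > 0"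
    using \<open>open \<Omega>\<close> \<open>\<Omega> \<noteq> {}\<close> fin
    by (metis less_eq_real_def measure_nonneg negligible_iff_measure open_not_negligible)
  then have "C > 0"
    by (simp add: C_def)
  moreover have "phi_star_norm \<phi> \<psi> \<sigma> \<Omega> l u \<le> ennreal C * phi_loc_Lip_norm \<phi> k \<psi> \<sigma> \<Omega> l u"
    for u :: "'n diff_form"
    unfolding phi_star_norm_def
  proof (rule SUP_least)
    fix B assume B: "B \<in> admissible_balls \<sigma> \<Omega>"
    define w where "w = measure lebesgue B powr (- (real CARD('n) + k) / real CARD('n))"
    have "measure lebesgue B > 0"
      using B by (auto simp: admissible_balls_def content_ball_pos)
    moreover have "measure lebesgue B \<le> measure lebesgue \<Omega>"
      using admissible_ball_subset[OF B \<open>\<sigma> > 1\<close>] fin B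
      by (intro measure_mono_fmeasurable) (auto simp: admissible_balls_def)
    ultimately have "inverse (measure lebesgue B) \<le> C * w"
      unfolding C_def w_def using \<open>0 < k\<close> by (intro inverse_le_powr_mult_powr) auto
    \<comment> \<open>The oscillation may be infinite; multiplication in \<open>ennreal\<close> is
      monotone in that case too.\<close>
    then have "ennreal (inverse (measure lebesgue B)) * oscillation \<phi> (\<psi> B) B l u
        \<le> ennreal (C * w) * oscillation \<phi> (\<psi> B) B l u"
      by (intro mult_right_mono ennreal_leI) auto
    also have "\<dots> = ennreal C * (ennreal w * oscillation \<phi> (\<psi> B) B l u)"
      using \<open>C > 0\<close> by (simp add: ennreal_mult w_def mult.assoc)
    \<comment> \<open>Both suprema run over the same balls with the same \<open>\<psi> B\<close>, so
      the weighted oscillation on \<open>B\<close> is one term of the Lipschitz supremum.\<close>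
    also have "\<dots> \<le> ennreal C * phi_loc_Lip_norm \<phi> k \<psi> \<sigma> \<Omega> l u"
      unfolding phi_loc_Lip_norm_def w_def by (intro mult_left_mono SUP_upper B) simp
    finally show "ennreal (inverse (measure lebesgue B)) * oscillation \<phi> (\<psi> B) B l u
        \<le> ennreal C * phi_loc_Lip_norm \<phi> k \<psi> \<sigma> \<Omega> l u" .
  qed
  ultimately show ?thesis
    by blast
qed

end
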